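(* For every integer $n$ the following hold (with the stated additional restrictions on $n$): (i) for $n\ge 2$: $t_M([0,1/n])=t_M([(n-1)/n,1])=t_M([-1/n,1/n])=1/n$; (ii) for $n\ge 2$: $t_M([-1/\sqrt{n},1/\sqrt{n}])=\sqrt{t_M([0,1/n])}=1/\sqrt{n}$; (iii) $t_M([n,n+1/2])=t_M([n-1/2,n])=t_M([0,1/2])=1/2$; (iv) $t_M([n,n+1])=t_M([0,1])=\sqrt{t_M([0,1/4])}=1/2$; (v) $t_M([n,n+2])=t_M([-1,1])=\sqrt{t_M([0,1])}=1/\sqrt{2}$. Moreover, if $E$ is a compact set with $E\subset[(1-\sqrt2)/2,(1+\sqrt2)/2]$ and $1/2\in E$, then $$t_M(E)=t_M\big([(1-\sqrt2)/2,(1+\sqrt2)/2]\big)=t_M(\{1/2\})=1/2.$$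
   Context: For compact $E\subset\mathbb{C}$, $\|f\|_E:=\sup_{z\in E}|f(z)|$; $\mathcal{M}_n(\mathbb{Z})$ is the set of monic integer-coefficient polynomials of exact degree $n$; and the monic integer Chebyshev constant is $t_M(E):=\lim_{k\to\infty}\big(\inf_{P\in\mathcal{M}_k(\mathbb{Z})}\|P\|_E\big)^{1/k}$ (this limit exists). *)

theory Defs
  imports "HOL-Analysis.Analysis" "HOL-Computational_Algebra.Polynomial"
begin

definition monic_int_polys :: "nat \<Rightarrow> int poly set" where
  "monic_int_polys n = {P. degree P = n \<and> lead_coeff P = 1}"

text \<open>The supremum is only meaningful for nonempty \<open>E\<close> on which \<open>f\<close> is bounded,
  e.g. \<open>E\<close> nonempty compact and \<open>f\<close> continuous.\<close>

definition sup_norm_on :: "complex set \<Rightarrow> (complex \<Rightarrow> complex) \<Rightarrow> real" where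
  "sup_norm_on E f = (SUP z\<in>E. cmod (f z))"

text \<open>The term for \<open>k = 0\<close> is \<open>0\<close> by the convention \<open>root 0 x = 0\<close>
  and does not affect the limit.\<close>

definition monic_int_chebyshev :: "complex set \<Rightarrow> real" where
  "monic_int_chebyshev E =
     lim (\<lambda>k. root k (INF P\<in>monic_int_polys k. sup_norm_on E (poly (map_poly of_int P))))"

definition real_interval :: "real \<Rightarrow> real \<Rightarrow> complex set" where
  "real_interval a b = complex_of_real ` {a..b}"

end

(* Lower bounds: a monic integer polynomial of degree k takes a value of modulus at least b^(-k) at a
   reduced fraction a/b with b >= 2.  At a conjugate pair m +- 1/sqrt n the product of the two values is
   the value at 1/n of a polynomial that is monic up to sign, which gives n^(-k/2) for the larger one.
   Upper bounds come from powers of x - m, (x - m) (x - m - 1) and (x - m)^2 ((x - m)^2 - 1). *)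

theory Submission
  imports Defs
begin

subsection \<open>Computing the constant from matching bounds\<close>

lemma monic_int_polys_mult:
  assumes "P \<in> monic_int_polys m" "Q \<in> monic_int_polys n"
  shows "P * Q \<in> monic_int_polys (m + n)"
proof -
  have "P \<noteq> 0" "Q \<noteq> 0" using assms by (auto simp: monic_int_polys_def)
  then have "degree (P * Q) = m + n"
    using assms by (simp add: monic_int_polys_def degree_mult_eq)
  moreover have "lead_coeff (P * Q) = 1"
    unfolding lead_coeff_mult using assms by (auto simp: monic_int_polys_def)
  ultimately show ?thesis by (simp add: monic_int_polys_def)
qed

lemma monic_int_polys_power:
  assumes "P \<in> monic_int_polys m"
  shows "P ^ j \<in> monic_int_polys (m * j)"
proof (induction j)
  case (Suc j)
  then show ?case using monic_int_polys_mult[OF assms] by simp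
qed (simp add: monic_int_polys_def)

lemma poly_map_of_int_mult:
  "poly (map_poly of_int (P * Q)) x =
     poly (map_poly of_int P) x * poly (map_poly of_int Q) (x :: 'a :: comm_ring_1)"
proof -
  have "map_poly of_int (P * Q) = (map_poly of_int P * map_poly of_int Q :: 'a poly)"
    by (intro poly_eqI) (simp add: coeff_map_poly coeff_mult)
  then show ?thesis by simp
qed

lemma poly_map_of_int_of_real:
  "poly (map_poly of_int P) (of_real x :: complex) = of_real (poly (map_poly of_int P) x)"
  by (induction P) (simp_all add: map_poly_pCons)

text \<open>Compactness bounds the values of \<open>p\<close> on \<open>E\<close>; without a bound
  the conditionally complete \<open>SUP\<close> says nothing about single points.\<close>

lemma sup_norm_on_upper:
  assumes "compact E" "z \<in> E"
  shows "cmod (poly p z) \<le> sup_norm_on E (poly p)"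
proof -
  have "compact ((\<lambda>z. cmod (poly p z)) ` E)"
    by (intro compact_continuous_image continuous_intros assms)
  then show ?thesis
    unfolding sup_norm_on_def
    by (intro cSUP_upper assms bounded_imp_bdd_above compact_imp_bounded)
qed

text \<open>A single good \<open>Q\<close> of degree \<open>d\<close> controls all degrees: powers
  of \<open>Q\<close>, padded with fewer than \<open>d\<close> factors x, lose only a constant
  factor, and the k-th root of a constant tends to 1. The squeeze proves convergence as well, so
  \<open>lim\<close> has its intended value.\<close>

lemma monic_int_chebyshev_eqI:
  assumes E: "compact E" and c: "c > 0" and d: "d > 0"
    and Q: "Q \<in> monic_int_polys d"
    and upper: "\<And>z. z \<in> E \<Longrightarrow> cmod (poly (map_poly of_int Q) z) \<le> c ^ d"
    and lower: "\<And>k P. P \<in> monic_int_polys k \<Longrightarrow> \<exists>z\<in>E. c ^ k \<le> cmod (poly (map_poly of_int P) z)"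
  shows "monic_int_chebyshev E = c"
proof -
  define N where "N P = sup_norm_on E (poly (map_poly of_int P))" for P :: "int poly"
  define I where "I k = (INF P\<in>monic_int_polys k. N P)" for k
  have N_lower: "c ^ k \<le> N P" if "P \<in> monic_int_polys k" for k P
    using lower[OF that] sup_norm_on_upper[OF E] unfolding N_def by (meson order_trans)
  have X: "monom 1 k \<in> monic_int_polys k" for k
    by (simp add: monic_int_polys_def degree_monom_eq)
  \<comment> \<open>Any monic polynomial will do here: the lower bound for it supplies a point of
    \<open>E\<close>.\<close>
  then have "E \<noteq> {}" using lower by blast
  obtain M where M: "M \<ge> 1" "\<And>z. z \<in> E \<Longrightarrow> cmod z \<le> M"
    using compact_imp_bounded[OF E] unfolding bounded_iff
    by (metis max.cobounded1 max.coboundedI2)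
  \<comment> \<open>Bounds (M / c)^r for every remainder r < d, whether or not M / c exceeds 1, and
    is independent of the degree k.\<close>
  define K where "K = max 1 (M / c) ^ d"
  have "K \<ge> 1" unfolding K_def by simp
  have I_lower: "c ^ k \<le> I k" for k
    unfolding I_def using X N_lower by (intro cINF_greatest) auto
  have I_upper: "I k \<le> c ^ k * K" for k
  proof -
    \<comment> \<open>Division of k by d: \<open>Q ^ j\<close> has degree d * j, and x^r makes up
      the remaining degree.\<close>
    define j r where "j = k div d" and "r = k mod d"
    define P where "P = Q ^ j * monom 1 r"
    have k: "d * j + r = k" and "r < d" unfolding j_def r_def using d by simp_all
    then have P: "P \<in> monic_int_polys k"
      using monic_int_polys_mult[OF monic_int_polys_power[OF Q] X] unfolding P_def by metis
    have "cmod (poly (map_poly of_int P) z) \<le> c ^ k * K" if z: "z \<in> E" for z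
    proof -
      have pow: "poly (map_poly of_int (Q ^ i)) z = poly (map_poly of_int Q) z ^ i" for i
        by (induction i) (simp_all add: poly_map_of_int_mult)
      have "cmod (poly (map_poly of_int P) z) = cmod (poly (map_poly of_int Q) z) ^ j * cmod z ^ r"
        unfolding P_def poly_map_of_int_mult pow
        by (simp add: map_poly_monom poly_monom norm_mult norm_power)
      also have "\<dots> \<le> (c ^ d) ^ j * M ^ r"
        using upper[OF z] M c z by (intro mult_mono power_mono) auto
      also have "\<dots> = c ^ k * (M / c) ^ r"
        using c by (simp add: power_add power_mult power_divide flip: k)
      also have "\<dots> \<le> c ^ k * K"
      proof -
        have "(M / c) ^ r \<le> max 1 (M / c) ^ r"
          using M(1) c by (intro power_mono) auto
        also have "\<dots> \<le> K"
          unfolding K_def using \<open>r < d\<close> by (intro power_increasing) auto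
        finally show ?thesis using c by simp
      qed
      finally show ?thesis .
    qed
    then have "N P \<le> c ^ k * K"
      unfolding N_def sup_norm_on_def using \<open>E \<noteq> {}\<close> by (intro cSUP_least) auto
    moreover have "I k \<le> N P"
      unfolding I_def using P N_lower by (intro cINF_lower bdd_belowI2[of _ "c ^ k"]) auto
    ultimately show ?thesis by simp
  qed
  \<comment> \<open>The bounds c^k \<le> I k \<le> c^k * K become c and c * \<open>root k K\<close>
    after taking roots. This needs k > 0, since \<open>root 0\<close> is constantly 0.\<close>
  have "(\<lambda>k. root k (I k)) \<longlonglongrightarrow> c"
  proof (rule tendsto_sandwich)
    show "\<forall>\<^sub>F k in sequentially. c \<le> root k (I k)"
      using eventually_gt_at_top[of 0]
    proof eventually_elim
      case (elim k)
      then show ?case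
        using real_root_le_mono[OF elim I_lower[of k]] c by (simp add: real_root_power_cancel)
    qed
    show "\<forall>\<^sub>F k in sequentially. root k (I k) \<le> c * root k K"
      using eventually_gt_at_top[of 0]
    proof eventually_elim
      case (elim k)
      then show ?case
        using real_root_le_mono[OF elim I_upper[of k]] c
        by (simp add: real_root_mult real_root_power_cancel)
    qed
    show "(\<lambda>k. c * root k K) \<longlonglongrightarrow> c"
      using tendsto_mult[OF tendsto_const[of c] LIMSEQ_root_const[of K]] \<open>K \<ge> 1\<close> by simp
  qed simp
  then show ?thesis
    unfolding monic_int_chebyshev_def I_def N_def by (rule limI)
qed

lemma monic_int_chebyshev_real_eqI:
  assumes "compact (complex_of_real ` S)" "c > 0" "d > 0" "Q \<in> monic_int_polys d"
    and "\<And>x. x \<in> S \<Longrightarrow> \<bar>poly (map_poly of_int Q) x\<bar> \<le> c ^ d"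
    and "\<And>k P. P \<in> monic_int_polys k \<Longrightarrow> \<exists>x\<in>S. c ^ k \<le> \<bar>poly (map_poly of_int P) x\<bar>"
  shows "monic_int_chebyshev (complex_of_real ` S) = c"
  using assms by (intro monic_int_chebyshev_eqI) (auto simp: poly_map_of_int_of_real)

lemma compact_of_real_interval: "compact (complex_of_real ` {a..b})"
  by (intro compact_continuous_image continuous_intros) simp

lemma compact_real_interval: "compact (real_interval a b)"
  unfolding real_interval_def by (rule compact_of_real_interval)

subsection \<open>Lower bounds\<close>

text \<open>Clearing denominators turns b^k * P(a/b) into an integer congruent to a^k modulo b,
  because P is monic. As a is coprime to b and b is not a unit, this integer is nonzero, so its
  modulus is at least 1.\<close>

lemma monic_int_poly_at_fraction:
  fixes a b :: int
  assumes P: "P \<in> monic_int_polys k" and b: "b \<ge> 2" and "coprime a b"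
  shows "(1 / real_of_int b) ^ k \<le> \<bar>poly (map_poly of_int P) (of_int a / of_int b)\<bar>"
proof -
  define N where "N = (\<Sum>i\<le>k. coeff P i * a ^ i * b ^ (k - i))"
  have deg: "degree P = k" and lc: "coeff P k = 1" using P by (auto simp: monic_int_polys_def)
  have "poly (map_poly of_int P) (of_int a / of_int b :: real) * of_int b ^ k =
      (\<Sum>i\<le>k. of_int (coeff P i) * (of_int a / of_int b) ^ i * of_int b ^ k)"
    by (simp add: poly_altdef deg coeff_map_poly degree_map_poly sum_distrib_right)
  also have "\<dots> = of_int N"
    unfolding N_def of_int_sum
  proof (intro sum.cong refl)
    fix i assume "i \<in> {..k}"
    then have "real_of_int b ^ k = of_int b ^ i * of_int b ^ (k - i)" by (simp flip: power_add)
    then show "of_int (coeff P i) * (of_int a / of_int b) ^ i * of_int b ^ k =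
        real_of_int (coeff P i * a ^ i * b ^ (k - i))"
      using b by (simp add: power_divide)
  qed
  finally have N: "poly (map_poly of_int P) (of_int a / of_int b :: real) * of_int b ^ k = of_int N" .
  \<comment> \<open>Every term below the leading one keeps a factor b, since k - i > 0.\<close>
  have "N = (\<Sum>i<k. coeff P i * a ^ i * b ^ (k - i)) + a ^ k"
    unfolding N_def by (simp add: lc flip: lessThan_Suc_atMost)
  moreover have "b dvd (\<Sum>i<k. coeff P i * a ^ i * b ^ (k - i))"
    by (intro dvd_sum dvd_mult dvd_power) auto
  moreover have "\<not> b dvd a ^ k"
  proof
    assume "b dvd a ^ k"
    moreover have "coprime b (a ^ k)" using \<open>coprime a b\<close> by (simp add: coprime_commute)
    ultimately have "is_unit b" by (meson coprime_common_divisor dvd_refl)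
    then show False using b by simp
  qed
  ultimately have "N \<noteq> 0" by (metis dvd_0_right dvd_add_right_iff)
  then have "1 \<le> \<bar>real_of_int N\<bar>" by linarith
  then have "1 \<le> \<bar>poly (map_poly of_int P) (of_int a / of_int b :: real)\<bar> * of_int b ^ k"
    using b by (simp add: abs_mult flip: N)
  then show ?thesis using b by (simp add: field_simps)
qed

text \<open>The product p(x) * p(-x) is even, hence a polynomial in x^2. With the even-odd splitting
  p = A(x^2) + x * B(x^2) it equals A(x^2)^2 - x^2 * B(x^2)^2, so q = A^2 - x * B^2 works over any
  commutative ring.\<close>

lemma ex_poly_square_substitution:
  fixes p :: "'a :: comm_ring_1 poly"
  shows "\<exists>q. pcompose q [:0, 0, 1:] = p * pcompose p [:0, -1:]"
proof -
  have "\<exists>A B. p = pcompose A [:0, 0, 1:] + [:0, 1:] * pcompose B [:0, 0, 1:]"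
  proof (induction p)
    case 0
    show ?case by (rule exI[of _ 0], rule exI[of _ 0]) simp
  next
    case (pCons a p)
    then obtain A B where "p = pcompose A [:0, 0, 1:] + [:0, 1:] * pcompose B [:0, 0, 1:]" by blast
    \<comment> \<open>Multiplication by x exchanges the even and odd parts; the factor x^2 that
      arises from x * x is absorbed into \<open>pCons a B\<close>.\<close>
    then have "pCons a p = pcompose (pCons a B) [:0, 0, 1:] + [:0, 1:] * pcompose A [:0, 0, 1:]"
      by (simp add: pcompose_pCons)
    then show ?case by blast
  qed
  then obtain A B where p: "p = pcompose A [:0, 0, 1:] + [:0, 1:] * pcompose B [:0, 0, 1:]" by blast
  have "pcompose [:0, 0, 1:] [:0, -1:] = ([:0, 0, 1:] :: 'a poly)" by (simp add: pcompose_pCons)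
  then have mp: "pcompose p [:0, -1:] = pcompose A [:0, 0, 1:] - [:0, 1:] * pcompose B [:0, 0, 1:]"
    by (subst p) (simp add: pcompose_add pcompose_mult pcompose_pCons flip: pcompose_assoc)
  then have "p * pcompose p [:0, -1:] =
      pcompose A [:0, 0, 1:] ^ 2 - [:0, 1:] ^ 2 * pcompose B [:0, 0, 1:] ^ 2"
    unfolding mp by (subst p) (simp only: power2_eq_square algebra_simps)
  also have "\<dots> = pcompose (A ^ 2 - [:0, 1:] * B ^ 2) [:0, 0, 1:]"
    by (simp add: pcompose_diff pcompose_mult power2_eq_square pcompose_pCons)
  finally show ?thesis by metis
qed

lemma poly_map_of_int_pcompose:
  "poly (map_poly of_int (pcompose P Q)) x =
     poly (map_poly of_int P) (poly (map_poly of_int Q) x :: real)"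
proof (induction P)
  case (pCons a P)
  have "map_poly of_int (A + B) = (map_poly of_int A + map_poly of_int B :: real poly)" for A B
    by (intro poly_eqI) (simp add: coeff_map_poly)
  with pCons show ?case by (simp add: pcompose_pCons map_poly_pCons poly_map_of_int_mult)
qed simp

text \<open>The two points are conjugate, so the bound at a fraction applies to the product of the
  two values and yields (1/n)^k = (1 / sqrt n)^(2k). At least one factor must reach the square root
  of this. The argument does not distinguish whether n is a square.\<close>

lemma monic_int_poly_at_sqrt:
  fixes n m :: int
  assumes P: "P \<in> monic_int_polys k" and n: "n \<ge> 2"
  shows "\<exists>x\<in>{of_int m - 1 / sqrt n, of_int m + 1 / sqrt n}.
           (1 / sqrt n) ^ k \<le> \<bar>poly (map_poly of_int P) x\<bar>"
proof -
  let ?ev = "\<lambda>P. poly (map_poly of_int P) :: real \<Rightarrow> real"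
  let ?s = "1 / sqrt n"
  \<comment> \<open>The shift by m moves the conjugate pair to a pair of opposite numbers.\<close>
  define R where "R = pcompose P [:m, 1:]"
  have P': "degree P = k" "lead_coeff P = 1" using P by (auto simp: monic_int_polys_def)
  have "lead_coeff R = lead_coeff P" unfolding R_def by (subst lead_coeff_comp) simp_all
  then have R: "degree R = k" "lead_coeff R = 1"
    using P' by (simp_all add: R_def degree_pcompose)
  have evR: "?ev R x = ?ev P (of_int m + x)" for x
    unfolding R_def by (simp add: poly_map_of_int_pcompose map_poly_pCons)
  obtain q where q: "pcompose q [:0, 0, 1:] = R * pcompose R [:0, -1:]"
    using ex_poly_square_substitution by blast
  have "R \<noteq> 0" "pcompose R [:0, -1:] \<noteq> 0"
    using R by (auto simp: pcompose_eq_0_iff)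
  then have "degree (R * pcompose R [:0, -1:]) = 2 * k"
    using R by (simp add: degree_mult_eq degree_pcompose)
  then have deg: "degree q = k" by (simp add: degree_pcompose flip: q)
  have "lead_coeff (pcompose q [:0, 0, 1:]) = lead_coeff q"
    by (subst lead_coeff_comp) simp_all
  \<comment> \<open>The sign comes from R(-x), whose leading coefficient is (-1)^k; \<open>Q\<close>
    removes it to become monic.\<close>
  then have lc: "lead_coeff q = (-1) ^ k"
    using R by (simp add: q lead_coeff_mult lead_coeff_comp)
  define Q where "Q = smult ((-1) ^ k) q"
  have "Q \<in> monic_int_polys k"
    using deg lc by (simp add: Q_def monic_int_polys_def flip: power_mult_distrib)
  then have "(1 / of_int n) ^ k \<le> \<bar>?ev Q (1 / of_int n)\<bar>"
    using monic_int_poly_at_fraction[of Q k n 1] n by simp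
  also have "?ev Q x = (-1) ^ k * ?ev q x" for x
    unfolding Q_def using poly_map_of_int_mult[of "[:(-1) ^ k:]" q x] by (simp add: map_poly_pCons)
  then have "\<bar>?ev Q (1 / of_int n)\<bar> = \<bar>?ev q (1 / of_int n)\<bar>"
    by (simp add: abs_mult power_abs)
  also have "?ev q (1 / of_int n) = ?ev (pcompose q [:0, 0, 1:]) ?s"
    using n by (simp add: poly_map_of_int_pcompose map_poly_pCons)
  also have "\<dots> = ?ev P (of_int m + ?s) * ?ev P (of_int m - ?s)"
    unfolding q poly_map_of_int_mult by (simp add: poly_map_of_int_pcompose map_poly_pCons evR)
  also have "(1 / real_of_int n) ^ k = ?s ^ k * ?s ^ k"
    using n by (simp flip: power_mult_distrib)
  finally have *: "?s ^ k * ?s ^ k \<le> \<bar>?ev P (of_int m + ?s)\<bar> * \<bar>?ev P (of_int m - ?s)\<bar>"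
    by (simp add: abs_mult)
  have "?s ^ k \<le> \<bar>?ev P (of_int m + ?s)\<bar> \<or> ?s ^ k \<le> \<bar>?ev P (of_int m - ?s)\<bar>"
  proof (rule ccontr)
    assume "\<not> ?thesis"
    then have "\<bar>?ev P (of_int m + ?s)\<bar> * \<bar>?ev P (of_int m - ?s)\<bar> < ?s ^ k * ?s ^ k"
      by (intro mult_strict_mono) auto
    with * show False by simp
  qed
  then show ?thesis by auto
qed

subsection \<open>Intervals\<close>

text \<open>The linear polynomial x - m has modulus at most 1/b on the interval, and the reduced
  fraction a/b in it forces the matching lower bound.\<close>

lemma monic_int_chebyshev_fraction:
  fixes a b m :: int
  assumes "b \<ge> 2" "coprime a b" "of_int a / of_int b \<in> {l..u}"
    and "of_int m - 1 / of_int b \<le> l" "u \<le> of_int m + 1 / of_int b"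
  shows "monic_int_chebyshev (real_interval l u) = 1 / of_int b"
  unfolding real_interval_def
proof (rule monic_int_chebyshev_real_eqI)
  show "[:-m, 1:] \<in> monic_int_polys 1" by (simp add: monic_int_polys_def)
  show "\<bar>poly (map_poly of_int [:-m, 1:]) x\<bar> \<le> (1 / real_of_int b) ^ 1" if "x \<in> {l..u}" for x
    using that assms by (auto simp: map_poly_pCons abs_le_iff)
  show "\<exists>x\<in>{l..u}. (1 / real_of_int b) ^ k \<le> \<bar>poly (map_poly of_int P) x\<bar>"
    if "P \<in> monic_int_polys k" for k P
    using monic_int_poly_at_fraction[OF that assms(1,2)] assms(3) by blast
qed (use assms in \<open>auto intro: compact_of_real_interval\<close>)

text \<open>Both endpoints form the conjugate pair about 0, and the polynomial x attains the bound
  they force.\<close>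

lemma monic_int_chebyshev_sqrt:
  fixes n :: int
  assumes n: "n \<ge> 2"
  shows "monic_int_chebyshev (real_interval (- (1 / sqrt n)) (1 / sqrt n)) = 1 / sqrt n"
  unfolding real_interval_def
proof (rule monic_int_chebyshev_real_eqI)
  show "[:0, 1:] \<in> monic_int_polys 1" by (simp add: monic_int_polys_def)
  show "\<exists>x\<in>{- (1 / sqrt n)..1 / sqrt n}. (1 / sqrt n) ^ k \<le> \<bar>poly (map_poly of_int P) x\<bar>"
    if "P \<in> monic_int_polys k" for k P
    using monic_int_poly_at_sqrt[OF that n, of 0] n by auto
qed (use n in \<open>auto intro: compact_of_real_interval simp: map_poly_pCons abs_le_iff\<close>)

text \<open>On the interval of radius \<open>1 / sqrt 2\<close> about \<open>m + 1/2\<close> one has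
  \<open>(x - m) * (x - m - 1) = (x - m - 1/2)\<^sup>2 - 1/4\<close>, of modulus at most \<open>1/4\<close>.\<close>

lemma monic_int_chebyshev_half_integer:
  fixes m :: int
  assumes E: "compact E" "E \<subseteq> real_interval (m + (1 - sqrt 2) / 2) (m + (1 + sqrt 2) / 2)"
    and "of_int m + 1 / 2 \<in> E"
  shows "monic_int_chebyshev E = 1 / 2"
proof -
  obtain S where S: "S \<subseteq> {m + (1 - sqrt 2) / 2..m + (1 + sqrt 2) / 2}" "E = complex_of_real ` S"
    using E(2) unfolding real_interval_def by (auto elim: subset_imageE)
  have "complex_of_real (of_int m + 1 / 2) \<in> complex_of_real ` S" using assms(3) S(2) by simp
  \<comment> \<open>The midpoint is written as a fraction with odd numerator over 2, the reduced
    form that the lower bound requires.\<close>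
  then have mid: "of_int (2 * m + 1) / of_int 2 \<in> S"
    by (auto simp: inj_image_mem_iff inj_of_real add_divide_distrib simp del: of_real_add)
  show ?thesis
    unfolding S(2)
  proof (rule monic_int_chebyshev_real_eqI)
    \<comment> \<open>The coefficients are those of (x - m) * (x - m - 1).\<close>
    show "[:m * (m + 1), - (2 * m + 1), 1:] \<in> monic_int_polys 2"
      by (simp add: monic_int_polys_def)
    show "\<bar>poly (map_poly of_int [:m * (m + 1), - (2 * m + 1), 1:]) x\<bar> \<le> (1 / 2) ^ 2"
      if "x \<in> S" for x :: real
    proof -
      have "\<bar>x - m - 1 / 2\<bar> \<le> sqrt 2 / 2"
        using that S(1) unfolding abs_le_iff diff_divide_distrib add_divide_distrib by fastforce
      then have "(x - m - 1 / 2) ^ 2 \<le> (sqrt 2 / 2) ^ 2" by (rule abs_le_square_iff[THEN iffD1, OF order_trans]) simp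
      then have "(x - m - 1 / 2) ^ 2 \<le> 1 / 2" by (simp add: power_divide)
      moreover have "poly (map_poly of_int [:m * (m + 1), - (2 * m + 1), 1:]) x = (x - m - 1 / 2) ^ 2 - 1 / 4"
        by (simp add: map_poly_pCons power2_eq_square field_simps)
      \<comment> \<open>A square between 0 and 1/2, lowered by 1/4, lies between -1/4 and
        1/4.\<close>
      ultimately show ?thesis
        using zero_le_power2[of "x - m - 1 / 2"] unfolding abs_le_iff power_divide by simp
    qed
    show "\<exists>x\<in>S. (1 / 2) ^ k \<le> \<bar>poly (map_poly of_int P) x\<bar>" if "P \<in> monic_int_polys k" for k P
      using monic_int_poly_at_fraction[OF that, of 2 "2 * m + 1"] mid by fastforce
  qed (use E S in auto)
qed

lemma monic_int_chebyshev_length_one: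
  fixes m :: int
  shows "monic_int_chebyshev (real_interval (of_int m) (of_int m + 1)) = 1 / 2"
proof (rule monic_int_chebyshev_half_integer)
  have "1 \<le> sqrt (2 :: real)" by simp
  then show "real_interval (of_int m) (of_int m + 1) \<subseteq> real_interval (m + (1 - sqrt 2) / 2) (m + (1 + sqrt 2) / 2)"
    unfolding real_interval_def by (intro image_mono) auto
  show "of_int m + 1 / 2 \<in> real_interval (of_int m) (of_int m + 1)"
    unfolding real_interval_def by (rule image_eqI[of _ _ "m + 1 / 2"]) simp_all
qed (rule compact_real_interval)

text \<open>On [0,1] the polynomial y * (y - 1) has modulus at most 1/4. Substituting y = (x - m)^2
  gives degree 4 with the same bound 1/4 = (1 / sqrt 2)^4. The lower bound comes from the conjugate
  pair m +- 1 / sqrt 2 inside the interval.\<close>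

lemma monic_int_chebyshev_length_two:
  fixes m :: int
  shows "monic_int_chebyshev (real_interval (of_int m - 1) (of_int m + 1)) = 1 / sqrt 2"
  unfolding real_interval_def
proof (rule monic_int_chebyshev_real_eqI)
  \<comment> \<open>A double root at the centre m and simple roots at the endpoints m + 1 and m -
    1.\<close>
  let ?Q = "[:-m, 1:] * [:-m, 1:] * [:-m - 1, 1:] * [:-m + 1, 1:]"
  have lin: "[:c, 1:] \<in> monic_int_polys 1" for c by (simp add: monic_int_polys_def)
  show "?Q \<in> monic_int_polys (1 + 1 + 1 + 1)"
    by (intro monic_int_polys_mult lin)
  show "\<bar>poly (map_poly of_int ?Q) x\<bar> \<le> (1 / sqrt 2) ^ (1 + 1 + 1 + 1)"
    if "x \<in> {real_of_int m - 1..real_of_int m + 1}" for x :: real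
  proof -
    define y where "y = (x - m) ^ 2"
    have "poly (map_poly of_int ?Q) x = (x - m) * (x - m) * (x - m - 1) * (x - m + 1)"
      unfolding poly_map_of_int_mult by (simp add: map_poly_pCons algebra_simps)
    also have "\<dots> = - (y * (1 - y))" by (simp add: y_def power2_eq_square algebra_simps)
    finally have "poly (map_poly of_int ?Q) x = - (y * (1 - y))" .
    moreover have "0 \<le> y" "y \<le> 1"
      using that by (auto simp: y_def abs_square_le_1 abs_le_iff)
    then have "0 \<le> y * (1 - y)" by simp
    \<comment> \<open>This is (y - 1/2)^2 \<ge> 0 expanded.\<close>
    moreover have "y * (1 - y) \<le> 1 / 4"
      using zero_le_power2[of "y - 1 / 2"] by (simp add: power2_eq_square field_simps)
    moreover have "(1 / sqrt 2) ^ (1 + 1 + 1 + 1) = (1 / 4 :: real)"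
      by (simp add: power_add)
    ultimately show ?thesis by (simp only: abs_minus_cancel abs_of_nonneg)
  qed
  show "\<exists>x\<in>{real_of_int m - 1..real_of_int m + 1}. (1 / sqrt 2) ^ k \<le> \<bar>poly (map_poly of_int P) x\<bar>"
    if "P \<in> monic_int_polys k" for k P
  proof -
    have "- 1 \<le> 1 / sqrt 2" by (rule order_trans[of _ 0]) simp_all
    then have "{m - 1 / sqrt 2, m + 1 / sqrt 2} \<subseteq> {real_of_int m - 1..real_of_int m + 1}" by simp
    with monic_int_poly_at_sqrt[OF that, of 2 m] show ?thesis by auto
  qed
qed (auto intro: compact_of_real_interval)

theorem theorem1p6:
  shows
    "(\<forall>n::int. n \<ge> 2 \<longrightarrow>
        monic_int_chebyshev (real_interval 0 (1 / real_of_int n)) = 1 / real_of_int n \<and>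
        monic_int_chebyshev (real_interval ((real_of_int n - 1) / real_of_int n) 1) = 1 / real_of_int n \<and>
        monic_int_chebyshev (real_interval (- (1 / real_of_int n)) (1 / real_of_int n)) = 1 / real_of_int n)
   \<and> (\<forall>n::int. n \<ge> 2 \<longrightarrow>
        monic_int_chebyshev (real_interval (- (1 / sqrt (real_of_int n))) (1 / sqrt (real_of_int n)))
          = sqrt (monic_int_chebyshev (real_interval 0 (1 / real_of_int n))) \<and>
        sqrt (monic_int_chebyshev (real_interval 0 (1 / real_of_int n))) = 1 / sqrt (real_of_int n))
   \<and> (\<forall>n::int.
        monic_int_chebyshev (real_interval (real_of_int n) (real_of_int n + 1/2)) = 1/2 \<and>
        monic_int_chebyshev (real_interval (real_of_int n - 1/2) (real_of_int n)) = 1/2 \<and>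
        monic_int_chebyshev (real_interval 0 (1/2)) = 1/2)
   \<and> (\<forall>n::int.
        monic_int_chebyshev (real_interval (real_of_int n) (real_of_int n + 1))
          = monic_int_chebyshev (real_interval 0 1) \<and>
        monic_int_chebyshev (real_interval 0 1)
          = sqrt (monic_int_chebyshev (real_interval 0 (1/4))) \<and>
        sqrt (monic_int_chebyshev (real_interval 0 (1/4))) = 1/2)
   \<and> (\<forall>n::int.
        monic_int_chebyshev (real_interval (real_of_int n) (real_of_int n + 2))
          = monic_int_chebyshev (real_interval (-1) 1) \<and>
        monic_int_chebyshev (real_interval (-1) 1)
          = sqrt (monic_int_chebyshev (real_interval 0 1)) \<and>
        sqrt (monic_int_chebyshev (real_interval 0 1)) = 1 / sqrt 2)
   \<and> (\<forall>E::complex set.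
        compact E \<and> E \<subseteq> real_interval ((1 - sqrt 2) / 2) ((1 + sqrt 2) / 2) \<and> 1/2 \<in> E \<longrightarrow>
        monic_int_chebyshev E
          = monic_int_chebyshev (real_interval ((1 - sqrt 2) / 2) ((1 + sqrt 2) / 2)) \<and>
        monic_int_chebyshev (real_interval ((1 - sqrt 2) / 2) ((1 + sqrt 2) / 2))
          = monic_int_chebyshev {1/2} \<and>
        monic_int_chebyshev {1/2} = 1/2)"
proof (intro conjI allI impI)
  fix n :: int
  assume n: "n \<ge> 2"
  show zero: "monic_int_chebyshev (real_interval 0 (1 / real_of_int n)) = 1 / real_of_int n"
    using n by (intro monic_int_chebyshev_fraction[of n 1 _ _ 0]) auto
  \<comment> \<open>Here the linear polynomial is x - 1, and the left endpoint (n - 1)/n is reduced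
    because consecutive integers are coprime.\<close>
  show "monic_int_chebyshev (real_interval ((real_of_int n - 1) / real_of_int n) 1) = 1 / real_of_int n"
    using n by (intro monic_int_chebyshev_fraction[of n "n - 1" _ _ 1])
      (auto simp: field_simps coprime_diff_one_left)
  show "monic_int_chebyshev (real_interval (- (1 / real_of_int n)) (1 / real_of_int n)) = 1 / real_of_int n"
    using n by (intro monic_int_chebyshev_fraction[of n 1 _ _ 0]) auto
  show sq: "sqrt (monic_int_chebyshev (real_interval 0 (1 / real_of_int n))) = 1 / sqrt (real_of_int n)"
    unfolding zero by (simp add: real_sqrt_divide)
  show "monic_int_chebyshev (real_interval (- (1 / sqrt (real_of_int n))) (1 / sqrt (real_of_int n)))
          = sqrt (monic_int_chebyshev (real_interval 0 (1 / real_of_int n)))"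
    unfolding sq by (rule monic_int_chebyshev_sqrt[OF n])
next
  fix n :: int
  show "monic_int_chebyshev (real_interval (real_of_int n) (real_of_int n + 1/2)) = 1/2"
    \<comment> \<open>The half-integer endpoint is the fraction (2n + 1)/2, and the integer endpoint
      n is the root of the linear polynomial.\<close>
    using monic_int_chebyshev_fraction[of 2 "2 * n + 1" n "n + 1/2" n] by (simp add: add_divide_distrib)
  show "monic_int_chebyshev (real_interval (real_of_int n - 1/2) (real_of_int n)) = 1/2"
    using monic_int_chebyshev_fraction[of 2 "2 * n - 1" "n - 1/2" n n] by (simp add: diff_divide_distrib)
  show "monic_int_chebyshev (real_interval 0 (1/2)) = 1/2"
    using monic_int_chebyshev_fraction[of 2 1 0 "1/2" 0] by simp
next
  fix n :: int
  have one: "monic_int_chebyshev (real_interval 0 1) = 1 / 2"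
    using monic_int_chebyshev_length_one[of 0] by simp
  have "monic_int_chebyshev (real_interval 0 (1/4)) = 1/4"
    using monic_int_chebyshev_fraction[of 4 1 0 "1/4" 0] by simp
  then show quarter: "sqrt (monic_int_chebyshev (real_interval 0 (1/4))) = 1/2"
    by (simp only: real_sqrt_divide) simp
  show "monic_int_chebyshev (real_interval 0 1) = sqrt (monic_int_chebyshev (real_interval 0 (1/4)))"
    unfolding one quarter ..
  show "monic_int_chebyshev (real_interval (real_of_int n) (real_of_int n + 1))
          = monic_int_chebyshev (real_interval 0 1)"
    unfolding one by (rule monic_int_chebyshev_length_one)
  show sq: "sqrt (monic_int_chebyshev (real_interval 0 1)) = 1 / sqrt 2"
    unfolding one by (simp add: real_sqrt_divide)
  have two: "monic_int_chebyshev (real_interval (-1) 1) = 1 / sqrt 2"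
    using monic_int_chebyshev_length_two[of 0] by simp
  show "monic_int_chebyshev (real_interval (-1) 1) = sqrt (monic_int_chebyshev (real_interval 0 1))"
    unfolding two sq ..
  \<comment> \<open>The interval is centred at n + 1.\<close>
  show "monic_int_chebyshev (real_interval (real_of_int n) (real_of_int n + 2))
          = monic_int_chebyshev (real_interval (-1) 1)"
    unfolding two using monic_int_chebyshev_length_two[of "n + 1"] by (simp add: add.commute)
next
  let ?J = "real_interval ((1 - sqrt 2) / 2) ((1 + sqrt 2) / 2)"
  \<comment> \<open>The case m = 0 covers all three sets at once: \<open>E\<close>, the whole
    interval \<open>?J\<close> and the single point 1/2 are compact subsets of \<open>?J\<close>
    containing 1/2.\<close>
  have half: "monic_int_chebyshev E = 1 / 2" if "compact E" "E \<subseteq> ?J" "1 / 2 \<in> E" for E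
    using that monic_int_chebyshev_half_integer[of E 0] by simp
  have mid: "1 / 2 \<in> ?J"
    unfolding real_interval_def by (rule image_eqI[of _ _ "1 / 2"]) simp_all
  have J: "monic_int_chebyshev ?J = 1 / 2"
    using mid by (intro half compact_real_interval) auto
  show pt: "monic_int_chebyshev {1/2} = 1/2"
    using mid by (intro half) auto
  show "monic_int_chebyshev ?J = monic_int_chebyshev {1/2}"
    unfolding J pt ..
  show "monic_int_chebyshev E = monic_int_chebyshev ?J"
    if "compact E \<and> E \<subseteq> ?J \<and> 1/2 \<in> E" for E
    unfolding J using that by (intro half) auto
qed

end
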